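(* Suppose $f\in C^1(\mathbb R^d)$ is a definable function with a locally Lipschitz continuous gradient $\nabla f$, and let $\bar x$ be a critical point of $f$ that is not a local maximizer. If $f$ satisfies the Kurdyka–Łojasiewicz (KL) property at $\bar x$ with a desingularization function $\varphi$, then, after possibly shrinking the domain of $\varphi$, the function $$\phi_{\bar x}(t):=\frac{1}{(\varphi'(t))^2}$$ satisfies $\phi_{\bar x}(t)=O(t)$ as $t\downarrow0$. Consequently, $1/\phi_{\bar x}=(\varphi')^2$ is not integrable near $0$. In particular, $f$ cannot satisfy the KL property with an exponent $\kappa\in[0,1/2)$ at $\bar x$.
   Context: "Definable" means definable in a fixed o-minimal structure over the real field. KL property. A function $f\in C^1(\mathbb R^d)$ satisfies the KL property at $\bar x$ if there exist $\delta,\eta\in(0,+\infty]$ and a continuous concave function $\varphi:[0,\eta)\to\mathbb R_+$ with $\varphi(0)=0$, $\varphi$ continuously differentiable on $(0,\eta)$ and $\varphi'>0$ on $(0,\eta)$, such that $\varphi'(f(x)-f(\bar x))\,\|\nabla f(x)\|\ge1$ whenever $\|x-\bar x\|<\delta$ and $0<f(x)-f(\bar x)<\eta$. Such a $\varphi$ is called a desingularization function of $f$ at $\bar x$. $f$ has KL exponent $\kappa\in[0,1)$ at $\bar x$ if one may choose $\varphi(t)=\bar c\,t^{1-\kappa}$ for some $\bar c>0$. A nonnegative function on $(0,\eta)$ is integrable near $0$ if it is integrable on $(0,\eta']$ for some $\eta'\in(0,\eta)$. $\nabla f$ is locally Lipschitz continuous if every point has a neighborhood on which $\nabla f$ is Lipschitz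 continuous. *)

theory Defs
  imports "HOL-Analysis.Analysis" "HOL-Library.Landau_Symbols"
begin

text \<open>
  Since an o-minimal structure relates subsets of \<open>\<real>\<^sup>n\<close> for all \<open>n\<close> at once, points of
  \<open>\<real>\<^sup>n\<close> are represented as lists of length \<open>n\<close> in this part.
\<close>

inductive_set poly_functions :: "nat \<Rightarrow> (real list \<Rightarrow> real) set" for n :: nat where
  const: "(\<lambda>xs. c) \<in> poly_functions n"
| coord: "i < n \<Longrightarrow> (\<lambda>xs. xs ! i) \<in> poly_functions n"
| add: "p \<in> poly_functions n \<Longrightarrow> q \<in> poly_functions n \<Longrightarrow> (\<lambda>xs. p xs + q xs) \<in> poly_functions n"
| mult: "p \<in> poly_functions n \<Longrightarrow> q \<in> poly_functions n \<Longrightarrow> (\<lambda>xs. p xs * q xs) \<in> poly_functions n"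

text \<open>
  \<open>S n\<close> is the collection of definable subsets of \<open>\<real>\<^sup>n\<close>. Requiring all real algebraic sets
  to be definable is what makes this a structure over the real field. In the last axiom,
  intervals may be open, closed, half-open, unbounded or degenerate to a point.
\<close>

locale o_minimal_structure =
  fixes S :: "nat \<Rightarrow> real list set set"
  assumes dim: "A \<in> S n \<Longrightarrow> A \<subseteq> {xs. length xs = n}"
    and empty: "{} \<in> S n"
    and union: "A \<in> S n \<Longrightarrow> B \<in> S n \<Longrightarrow> A \<union> B \<in> S n"
    and compl: "A \<in> S n \<Longrightarrow> {xs. length xs = n} - A \<in> S n"
    and cylinder_left: "A \<in> S n \<Longrightarrow> {t # xs |t xs. xs \<in> A} \<in> S (Suc n)"
    and cylinder_right: "A \<in> S n \<Longrightarrow> {xs @ [t] |t xs. xs \<in> A} \<in> S (Suc n)"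
    and projection: "A \<in> S (Suc n) \<Longrightarrow> butlast ` A \<in> S n"
    and algebraic: "p \<in> poly_functions n \<Longrightarrow> {xs. length xs = n \<and> p xs = 0} \<in> S n"
    and o_minimal:
      "A \<in> S 1 \<longleftrightarrow> (\<exists>F :: real set set. finite F \<and> (\<forall>I\<in>F. is_interval I) \<and> A = (\<lambda>t. [t]) ` \<Union>F)"

text \<open>
  The graph of \<open>f\<close> is definable as a subset of \<open>\<real>\<^sup>d\<^sup>+\<^sup>1\<close>. The list \<open>js\<close> enumerates the
  coordinates; its choice is immaterial because an o-minimal structure is closed under
  permutation of coordinates.
\<close>

definition definable_function ::
    "(nat \<Rightarrow> real list set set) \<Rightarrow> (real^'d \<Rightarrow> real) \<Rightarrow> bool" where
  "definable_function S f \<longleftrightarrow>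
     (\<exists>js. distinct js \<and> set js = UNIV \<and>
        range (\<lambda>x. map (\<lambda>j. x $ j) js @ [f x]) \<in> S (CARD('d) + 1))"

definition gradient :: "(real^'d \<Rightarrow> real) \<Rightarrow> real^'d \<Rightarrow> real^'d" where
  "gradient f x = (THE g. GDERIV f x :> g)"

definition C1_function :: "(real^'d \<Rightarrow> real) \<Rightarrow> bool" where
  "C1_function f \<longleftrightarrow> (\<forall>x. f differentiable (at x)) \<and> continuous_on UNIV (gradient f)"

definition locally_lipschitz :: "(real^'d \<Rightarrow> real^'d) \<Rightarrow> bool" where
  "locally_lipschitz F \<longleftrightarrow> (\<forall>x. \<exists>U L. open U \<and> x \<in> U \<and> L-lipschitz_on U F)"

definition local_maximizer :: "(real^'d \<Rightarrow> real) \<Rightarrow> real^'d \<Rightarrow> bool" where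
  "local_maximizer f x \<longleftrightarrow> (\<forall>\<^sub>F y in nhds x. f y \<le> f x)"

text \<open>
  \<open>\<phi>\<close> is total in HOL, so its domain \<open>[0, \<eta>)\<close> is an explicit argument. On the open
  interval \<open>(0, \<eta>)\<close> the value of \<open>deriv \<phi>\<close> depends only on \<open>\<phi>\<close> restricted to the domain.
\<close>

definition desingularization :: "(real^'d \<Rightarrow> real) \<Rightarrow> real^'d \<Rightarrow> ereal \<Rightarrow> (real \<Rightarrow> real) \<Rightarrow> bool" where
  "desingularization f x0 \<eta> \<phi> \<longleftrightarrow>
     0 < \<eta> \<and>
     continuous_on {t. 0 \<le> t \<and> ereal t < \<eta>} \<phi> \<and>
     concave_on {t. 0 \<le> t \<and> ereal t < \<eta>} \<phi> \<and>
     (\<forall>t. 0 \<le> t \<and> ereal t < \<eta> \<longrightarrow> 0 \<le> \<phi> t) \<and>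
     \<phi> 0 = 0 \<and>
     (\<forall>t. 0 < t \<and> ereal t < \<eta> \<longrightarrow> \<phi> differentiable (at t)) \<and>
     continuous_on {t. 0 < t \<and> ereal t < \<eta>} (deriv \<phi>) \<and>
     (\<forall>t. 0 < t \<and> ereal t < \<eta> \<longrightarrow> 0 < deriv \<phi> t) \<and>
     (\<exists>\<delta>::ereal. 0 < \<delta> \<and>
        (\<forall>x. ereal (norm (x - x0)) < \<delta> \<and> 0 < f x - f x0 \<and> ereal (f x - f x0) < \<eta> \<longrightarrow>
             1 \<le> deriv \<phi> (f x - f x0) * norm (gradient f x)))"

definition KL_exponent :: "(real^'d \<Rightarrow> real) \<Rightarrow> real^'d \<Rightarrow> real \<Rightarrow> bool" where
  "KL_exponent f x0 \<kappa> \<longleftrightarrow>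
     0 \<le> \<kappa> \<and> \<kappa> < 1 \<and>
     (\<exists>\<eta> c. 0 < c \<and> desingularization f x0 \<eta> (\<lambda>t. c * t powr (1 - \<kappa>)))"

definition integrable_near_0 :: "ereal \<Rightarrow> (real \<Rightarrow> real) \<Rightarrow> bool" where
  "integrable_near_0 \<eta> g \<longleftrightarrow> (\<exists>\<eta>'. 0 < \<eta>' \<and> ereal \<eta>' < \<eta> \<and> set_integrable lebesgue {0<..\<eta>'} g)"

definition inverse_square_deriv :: "(real \<Rightarrow> real) \<Rightarrow> real \<Rightarrow> real" where
  "inverse_square_deriv \<phi> t = 1 / (deriv \<phi> t)^2"

lemma gradient_eqI:
  assumes "GDERIV f x :> g"
  shows "gradient f x = g"
  unfolding gradient_def
proof (rule the_equality)
  fix g' assume "GDERIV f x :> g'"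
  then have "(\<lambda>h. h \<bullet> g') = (\<lambda>h. h \<bullet> g)"
    using assms unfolding gderiv_def by (rule has_derivative_unique)
  then have "\<forall>h. h \<bullet> g' = h \<bullet> g"
    by (rule fun_cong[THEN allI])
  then show "g' = g"
    by (simp only: vector_eq_ldot)
qed (fact assms)

lemma GDERIV_gradient:
  assumes "f differentiable (at x)"
  shows "GDERIV f x :> gradient f x"
proof -
  from assms obtain D where D: "(f has_derivative D) (at x)"
    by (auto simp: differentiable_def)
  then have "linear D"
    by (rule has_derivative_linear)
  have "D h = h \<bullet> adjoint D 1" for h
    by (simp add: adjoint_works[OF \<open>linear D\<close>])
  then have "D = (\<lambda>h. h \<bullet> adjoint D 1)" ..
  with D have "GDERIV f x :> adjoint D 1"
    by (simp add: gderiv_def)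
  then show ?thesis by (simp add: gradient_eqI)
qed

end

theory Submission
  imports Defs
begin

text \<open>
  Write \<open>u = f - f xbar\<close> and let \<open>L\<close> be a Lipschitz constant of the gradient near \<open>xbar\<close>. Run gradient
  ascent with step \<open>1/(2L)\<close> from a point \<open>x0\<close> close to \<open>xbar\<close> with \<open>u x0 > 0\<close>. By the KL inequality
  and concavity, each step increases \<open>\<phi> \<circ> u\<close> by a fixed fraction of the length of the step, so the
  iterates stay near \<open>xbar\<close> until they reach a given small level \<open>t\<close>. A step from \<open>x\<close> to \<open>y\<close>
  increases \<open>u\<close> by a quantity comparable to \<open>|\<nabla>f x|\<^sup>2\<close>, hence to \<open>|\<nabla>f y|\<^sup>2\<close>; since \<open>u x > 0\<close>, this
  gives \<open>|\<nabla>f y|\<^sup>2 \<le> 9 L u y\<close>. At the first iterate with \<open>u y \<ge> t\<close> one has \<open>u y \<le> 8 t\<close>, so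
  \<open>\<phi>' t \<ge> \<phi>' (u y) \<ge> 1 / |\<nabla>f y|\<close> yields \<open>1 / (\<phi>' t)\<^sup>2 \<le> 72 L t\<close>.
\<close>

section \<open>Tangent lines of concave functions\<close>

lemma ereal_less_if_le:
  assumes "ereal t < e" "s \<le> t"
  shows "ereal s < e"
  using assms by (metis ereal_less_eq(3) le_less_trans)

lemma concave_on_imp_below_tangent:
  fixes \<phi> :: "real \<Rightarrow> real"
  assumes "concave_on A \<phi>" "connected A" "c \<in> interior A" "s \<in> A"
    and "(\<phi> has_real_derivative m) (at c)"
  shows "\<phi> s - \<phi> c \<le> m * (s - c)"
proof -
  have "((\<lambda>x. - \<phi> x) has_real_derivative - m) (at c within A)"
    by (rule has_field_derivative_at_within[OF DERIV_minus[OF assms(5)]])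
  then have "- m * (s - c) \<le> - \<phi> s - - \<phi> c"
    using assms(1-4)
    by (intro convex_on_imp_above_tangent[where f="\<lambda>x. - \<phi> x" and A=A])
      (simp_all add: concave_on_def)
  then show ?thesis by simp
qed

section \<open>Gradient ascent steps under a Lipschitz gradient\<close>

lemma gradient_linearization_bound:
  fixes f :: "real^'d \<Rightarrow> real"
  assumes diff: "\<And>x. f differentiable (at x)" and L: "L-lipschitz_on B (gradient f)"
    and "convex B" "x \<in> B" "y \<in> B"
  shows "\<bar>f y - f x - (y - x) \<bullet> gradient f x\<bar> \<le> L * (norm (y - x))^2"
proof -
  have sub: "closed_segment x y \<subseteq> B"
    using assms by (simp add: closed_segment_subset)
  \<comment> \<open>Along the segment the derivative differs from the one at \<open>x\<close> by at
    most \<open>L * norm (y - x)\<close> in operator norm. The mean value inequality thus yields the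
    constant \<open>L\<close> instead of the sharp \<open>L / 2\<close>, which is enough for the
    step factor \<open>1 / (2 * L)\<close>.\<close>
  have "norm (f y - f x - (y - x) \<bullet> gradient f x) \<le> norm (y - x) * (L * norm (y - x))"
  proof (rule differentiable_bound_linearization
      [where S="closed_segment x y" and f'="\<lambda>z h. h \<bullet> gradient f z"])
    show "x + t *\<^sub>R (y - x) \<in> closed_segment x y" if "t \<in> {0..1}" for t
      using that by (auto simp: closed_segment_def algebra_simps intro!: exI[of _ t])
    show "(f has_derivative (\<lambda>h. h \<bullet> gradient f z)) (at z within closed_segment x y)" for z
      using GDERIV_gradient[OF diff, of z] unfolding gderiv_def by (rule has_derivative_at_withinI)
    fix z assume z: "z \<in> closed_segment x y"
    have "norm (gradient f z - gradient f x) \<le> L * norm (z - x)"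
      using lipschitz_onD[OF L, of z x] z sub assms by (auto simp: dist_norm)
    also have "\<dots> \<le> L * norm (y - x)"
      using segment_bound1[OF z] lipschitz_on_nonneg[OF L]
      by (simp add: mult_left_mono norm_minus_commute)
    finally have b: "norm (gradient f z - gradient f x) \<le> L * norm (y - x)" .
    show "onorm ((\<lambda>h. h \<bullet> gradient f z) - (\<lambda>h. h \<bullet> gradient f x)) \<le> L * norm (y - x)"
    proof (rule onorm_le)
      fix h
      have "norm (h \<bullet> (gradient f z - gradient f x)) \<le> norm h * norm (gradient f z - gradient f x)"
        by (simp add: Cauchy_Schwarz_ineq2)
      also have "\<dots> \<le> norm h * (L * norm (y - x))"
        using b by (simp add: mult_left_mono)
      finally show "norm (((\<lambda>h. h \<bullet> gradient f z) - (\<lambda>h. h \<bullet> gradient f x)) h)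
          \<le> L * norm (y - x) * norm h"
        by (simp add: inner_diff_right mult_ac)
    qed
  qed auto
  then show ?thesis by (simp add: power2_eq_square mult_ac)
qed

text \<open>With g the gradient at \<open>x\<close>, the first-order gain is
  \<open>|g|^2 / (2 * L)\<close> and the error is at most half of it, so the gain lies between 1/4
  and 3/4 of \<open>|g|^2 / L\<close>. The gradient changes by at most half its norm, whence the
  factor 3/2.\<close>

lemma gradient_ascent_step:
  fixes f :: "real^'d \<Rightarrow> real"
  assumes diff: "\<And>x. f differentiable (at x)" and L: "L-lipschitz_on B (gradient f)"
    and "convex B" "0 < L" "x \<in> B" and y: "y = x + (1 / (2 * L)) *\<^sub>R gradient f x" "y \<in> B"
  shows "norm (y - x) = norm (gradient f x) / (2 * L)"
    and "(norm (gradient f x))^2 / (4 * L) \<le> f y - f x"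
    and "f y - f x \<le> 3 * (norm (gradient f x))^2 / (4 * L)"
    and "norm (gradient f y) \<le> 3 / 2 * norm (gradient f x)"
proof -
  let ?g = "norm (gradient f x)"
  show n: "norm (y - x) = ?g / (2 * L)"
    using \<open>0 < L\<close> by (simp add: y)
  have i: "(y - x) \<bullet> gradient f x = ?g^2 / (2 * L)"
    by (simp add: y power2_norm_eq_inner)
  have "L * (norm (y - x))^2 = ?g^2 / (4 * L)"
    using \<open>0 < L\<close> by (simp add: n power2_eq_square field_simps)
  then have "\<bar>f y - f x - ?g^2 / (2 * L)\<bar> \<le> ?g^2 / (4 * L)"
    using gradient_linearization_bound[OF diff L \<open>convex B\<close> \<open>x \<in> B\<close> \<open>y \<in> B\<close>] i by simp
  then show "?g^2 / (4 * L) \<le> f y - f x" "f y - f x \<le> 3 * ?g^2 / (4 * L)"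
    by (auto simp: abs_le_iff field_simps)
  have "norm (gradient f y - gradient f x) \<le> L * norm (y - x)"
    using lipschitz_onD[OF L \<open>y \<in> B\<close> \<open>x \<in> B\<close>] by (simp add: dist_norm)
  also have "\<dots> = ?g / 2"
    using \<open>0 < L\<close> by (simp add: n)
  finally show "norm (gradient f y) \<le> 3 / 2 * ?g"
    using norm_triangle_sub[of "gradient f y" "gradient f x"] by simp
qed

section \<open>Monotonicity of desingularization functions and of their derivatives\<close>

lemma
  assumes "desingularization f x0 \<eta> \<phi>"
  shows desingularization_pos: "0 < \<eta>"
    and desingularization_nonneg: "\<And>t. 0 \<le> t \<Longrightarrow> ereal t < \<eta> \<Longrightarrow> 0 \<le> \<phi> t"
    and desingularization_zero: "\<phi> 0 = 0"
    and desingularization_continuous: "continuous_on {t. 0 \<le> t \<and> ereal t < \<eta>} \<phi>"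
    and desingularization_deriv_pos: "\<And>t. 0 < t \<Longrightarrow> ereal t < \<eta> \<Longrightarrow> 0 < deriv \<phi> t"
    and desingularization_DERIV:
      "\<And>t. 0 < t \<Longrightarrow> ereal t < \<eta> \<Longrightarrow> (\<phi> has_real_derivative deriv \<phi> t) (at t)"
  using assms unfolding desingularization_def DERIV_deriv_iff_real_differentiable by blast+

lemma desingularization_tangent:
  assumes D: "desingularization f x0 \<eta> \<phi>" and "0 < c" "ereal c < \<eta>" "0 \<le> s" "ereal s < \<eta>"
  shows "\<phi> s - \<phi> c \<le> deriv \<phi> c * (s - c)"
proof (rule concave_on_imp_below_tangent)
  let ?A = "{t. 0 \<le> t \<and> ereal t < \<eta>}"
  show "concave_on ?A \<phi>" using D by (simp add: desingularization_def)
  have "is_interval ?A"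
    unfolding is_interval_1 by (auto elim: ereal_less_if_le)
  then show "connected ?A" by (rule is_interval_connected)
  have "open {t. 0 < t \<and> ereal t < \<eta>}"
    by (intro open_Collect_conj open_Collect_less continuous_intros)
  then show "c \<in> interior ?A"
    using assms by (intro interiorI[of "{t. 0 < t \<and> ereal t < \<eta>}"]) auto
  show "s \<in> ?A" using assms by simp
  show "(\<phi> has_real_derivative deriv \<phi> c) (at c)"
    using assms by (intro desingularization_DERIV[OF D])
qed

text \<open>Adding the tangent inequalities at \<open>s\<close> and at \<open>t\<close> cancels the
  values of \<open>\<phi>\<close> and leaves only the two slopes.\<close>

lemma desingularization_deriv_antimono:
  assumes D: "desingularization f x0 \<eta> \<phi>" and "0 < s" "s \<le> t" "ereal t < \<eta>"
  shows "deriv \<phi> t \<le> deriv \<phi> s"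
proof (cases "s = t")
  case False
  have s: "ereal s < \<eta>" using \<open>ereal t < \<eta>\<close> \<open>s \<le> t\<close> by (rule ereal_less_if_le)
  have "0 \<le> deriv \<phi> t * (s - t) + deriv \<phi> s * (t - s)"
    using desingularization_tangent[OF D, of t s] desingularization_tangent[OF D, of s t] assms s
    by simp
  then have "0 \<le> (deriv \<phi> s - deriv \<phi> t) * (t - s)" by (simp add: algebra_simps)
  then show ?thesis using False \<open>s \<le> t\<close> by (simp add: zero_le_mult_iff)
qed simp

lemma desingularization_mono:
  assumes D: "desingularization f x0 \<eta> \<phi>" and "0 < s" "s \<le> t" "ereal t < \<eta>"
  shows "\<phi> s \<le> \<phi> t"
proof -
  have "\<phi> s - \<phi> t \<le> deriv \<phi> t * (s - t)"
    using assms ereal_less_if_le[OF \<open>ereal t < \<eta>\<close> \<open>s \<le> t\<close>]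
    by (intro desingularization_tangent[OF D]) auto
  also have "\<dots> \<le> 0"
    using assms desingularization_deriv_pos[OF D, of t] by (simp add: mult_le_0_iff)
  finally show ?thesis by simp
qed

section \<open>The bound at a fixed level, and its uniform version near 0\<close>

lemma inverse_square_deriv_bound_at_level:
  fixes f :: "real^'d \<Rightarrow> real"
  assumes D: "desingularization f xbar \<eta> \<phi>"
    and KL: "\<And>x. \<lbrakk>norm (x - xbar) < r; 0 < f x - f xbar; ereal (f x - f xbar) < \<eta>\<rbrakk> \<Longrightarrow>
              1 \<le> deriv \<phi> (f x - f xbar) * norm (gradient f x)"
    and diff: "\<And>x. f differentiable (at x)"
    and L: "L-lipschitz_on (ball xbar r) (gradient f)" and "0 < L"
    and crit: "gradient f xbar = 0" and nmax: "\<not> local_maximizer f xbar"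
    and "0 < r" "0 < t" and \<eta>: "ereal (8 * t) < \<eta>" and small: "\<phi> (8 * t) < r / 12"
  shows "inverse_square_deriv \<phi> t \<le> 72 * L * t"
proof -
  define u where "u x = f x - f xbar" for x
  define G where "G x = norm (gradient f x)" for x
  define B where "B = ball xbar r"
  have G0: "0 \<le> G x" for x by (simp add: G_def)
  have lt_\<eta>: "ereal s < \<eta>" if "s \<le> 8 * t" for s
    using \<eta> that by (rule ereal_less_if_le)
  have G_le: "G x \<le> L * norm (x - xbar)" if "x \<in> B" for x
    using lipschitz_onD[OF L, of x xbar] that \<open>0 < r\<close> crit
    by (auto simp: G_def B_def dist_norm)
  have "isCont f xbar"
    using diff differentiable_imp_continuous_within by blast
  then have "\<forall>\<^sub>F y in nhds xbar. f y < f xbar + t"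
    using \<open>0 < t\<close> by (intro order_tendstoD(2)[of f "f xbar"]) (auto simp: isCont_def tendsto_nhds_iff)
  \<comment> \<open>The radius \<open>r / 4\<close> leaves room for the path of the iterates. The
    other term makes \<open>G x0\<close> at most \<open>3 * sqrt (L * t)\<close>: later iterates get
    their gradient bound from the preceding step, but \<open>x0\<close> has none.\<close>
  moreover define \<rho> where "\<rho> = min (r / 4) (3 * sqrt (t / L))"
  have "0 < \<rho>" using \<open>0 < r\<close> \<open>0 < t\<close> \<open>0 < L\<close> by (simp add: \<rho>_def)
  then have "\<forall>\<^sub>F y in nhds xbar. dist y xbar < \<rho>"
    by (auto simp: eventually_nhds_metric)
  \<comment> \<open>As \<open>xbar\<close> is not a local maximizer, every neighbourhood contains
    points with \<open>u > 0\<close>, in particular one where both eventual conditions hold.\<close>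
  moreover have "\<exists>\<^sub>F y in nhds xbar. f xbar < f y"
    using nmax by (simp add: local_maximizer_def frequently_def not_less)
  ultimately have "\<exists>\<^sub>F y in nhds xbar. f xbar < f y \<and> f y < f xbar + t \<and> dist y xbar < \<rho>"
    by - (erule frequently_rev_mp, erule (1) eventually_elim2, simp)
  then obtain x0 where x0: "0 < u x0" "u x0 < t" "norm (x0 - xbar) < \<rho>"
    by (auto simp: u_def dist_norm dest!: frequently_ex)
  have x0B: "x0 \<in> B" "norm (x0 - xbar) < r / 4"
    using x0(3) \<open>0 < r\<close> by (auto simp: B_def \<rho>_def dist_norm norm_minus_commute)
  have "G x0 \<le> L * (3 * sqrt (t / L))"
    using G_le[OF x0B(1)] x0(3) \<open>0 < L\<close> by (smt (verit) \<rho>_def mult_left_mono)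
  then have "(G x0)^2 \<le> (L * (3 * sqrt (t / L)))^2"
    using G0 by (simp add: power_mono)
  also have "\<dots> = 9 * L * t"
    using \<open>0 < L\<close> \<open>0 < t\<close> by (simp add: power_mult_distrib) (simp add: power2_eq_square)
  finally have G_x0: "(G x0)^2 \<le> 9 * L * t" .

  \<comment> \<open>Invariant of the iteration. Below level \<open>t\<close> the gradient bound
    reads \<open>9 * L * t\<close> and limits how far the next step can overshoot \<open>t\<close>;
    from level \<open>t\<close> on it reads \<open>9 * L * u x\<close>, the estimate wanted at the
    end. The last conjunct bounds the distance from the start by a telescoping potential.\<close>
  define P where "P x \<longleftrightarrow> u x0 \<le> u x \<and> u x \<le> 8 * t \<and> (G x)^2 \<le> 9 * L * max t (u x) \<and>
      norm (x - x0) \<le> 3 * (\<phi> (u x) - \<phi> (u x0))" for x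
  \<comment> \<open>Start and path contribute less than \<open>r / 4\<close> and
    \<open>3 * (r / 12)\<close>. Staying in the half ball leaves room for one further step.\<close>
  have near: "norm (x - xbar) < r / 2" if "P x" for x
  proof -
    have "\<phi> (u x) \<le> \<phi> (8 * t)"
      using that x0 \<eta> by (intro desingularization_mono[OF D]) (auto simp: P_def)
    moreover have "0 \<le> \<phi> (u x0)"
      using x0 \<open>0 < t\<close> by (intro desingularization_nonneg[OF D] lt_\<eta>) auto
    moreover have "norm (x - xbar) \<le> norm (x - x0) + norm (x0 - xbar)"
      using norm_triangle_ineq[of "x - x0" "x0 - xbar"] by simp
    ultimately show ?thesis using that x0B(2) small by (simp add: P_def)
  qed
  have KL': "1 \<le> deriv \<phi> (u x) * G x" if "norm (x - xbar) < r" "0 < u x" "u x \<le> 8 * t" for x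
    using KL[of x] that lt_\<eta>[of "u x"] by (simp add: u_def G_def)
  \<comment> \<open>A gain common to all steps: above level \<open>u x0\<close> the KL inequality
    and the antitone derivative keep \<open>G\<close> at least
    \<open>1 / deriv \<phi> (u x0)\<close>. It serves only to make the iteration terminate.\<close>
  define \<mu> where "\<mu> = (1 / deriv \<phi> (u x0))^2 / (4 * L)"
  have d0: "0 < deriv \<phi> (u x0)"
    using x0 \<open>0 < t\<close> by (intro desingularization_deriv_pos[OF D] lt_\<eta>) auto
  have "0 < \<mu>" using d0 \<open>0 < L\<close> by (simp add: \<mu>_def)
  have step: "\<exists>y. P y \<and> u x + \<mu> \<le> u y" if "P x" "u x < t" for x
  proof -
    note Px = \<open>P x\<close>[unfolded P_def]
    define y where "y = x + (1 / (2 * L)) *\<^sub>R gradient f x"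
    have xB: "x \<in> B" using near[OF \<open>P x\<close>] \<open>0 < r\<close>
      by (simp add: B_def dist_norm norm_minus_commute)
    \<comment> \<open>Membership of \<open>y\<close> in \<open>B\<close> must precede the ascent
      estimates. As \<open>xbar\<close> is critical, the step is at most half the distance from
      \<open>x\<close> to \<open>xbar\<close>, so \<open>y\<close> is within
      \<open>3 * r / 4\<close>.\<close>
    have "norm (y - xbar) \<le> norm (y - x) + norm (x - xbar)"
      using norm_triangle_ineq[of "y - x" "x - xbar"] by simp
    also have "norm (y - x) = G x / (2 * L)"
      using \<open>0 < L\<close> by (simp add: y_def G_def)
    also have "\<dots> \<le> norm (x - xbar) / 2"
      using G_le[OF xB] \<open>0 < L\<close> by (simp add: field_simps)
    finally have y_near: "norm (y - xbar) < r" using near[OF \<open>P x\<close>] \<open>0 < r\<close> by simp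
    then have yB: "y \<in> B" by (simp add: B_def dist_norm norm_minus_commute)
    have "convex B" by (simp add: B_def)
    note S = gradient_ascent_step[OF diff L[folded B_def] \<open>convex B\<close> \<open>0 < L\<close> xB y_def yB,
        folded G_def]
    have u_diff: "f y - f x = u y - u x" by (simp add: u_def)
    have ux: "0 < u x" using Px x0 by simp
    have Gx: "(G x)^2 \<le> 9 * L * t" using Px \<open>u x < t\<close> by simp
    have "1 \<le> deriv \<phi> (u x) * G x"
      using near[OF \<open>P x\<close>] \<open>0 < r\<close> ux Px by (intro KL') auto
    also have "\<dots> \<le> deriv \<phi> (u x0) * G x"
      using Px x0 by (intro mult_right_mono desingularization_deriv_antimono[OF D] lt_\<eta> G0) auto
    finally have G_lower: "1 / deriv \<phi> (u x0) \<le> G x"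
      using d0 by (simp add: field_simps)
    then have "(1 / deriv \<phi> (u x0))^2 \<le> (G x)^2"
      using d0 by (intro power_mono) auto
    then have "\<mu> \<le> (G x)^2 / (4 * L)"
      unfolding \<mu>_def using \<open>0 < L\<close> by (intro divide_right_mono) auto
    then have incr: "u x + \<mu> \<le> u y" using S(2) u_diff by simp
    \<comment> \<open>The gain is at most \<open>27 / 4 * t\<close>, and
      \<open>t + 27 / 4 * t\<close> is below \<open>8 * t\<close>.\<close>
    have "3 * (G x)^2 / (4 * L) \<le> 3 * (9 * L * t) / (4 * L)"
      using Gx \<open>0 < L\<close> by (intro divide_right_mono mult_left_mono) auto
    then have uy: "u y \<le> 8 * t"
      using S(3) u_diff \<open>u x < t\<close> \<open>0 < L\<close> \<open>0 < t\<close> by simp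
    \<comment> \<open>The gain pays for the new gradient: \<open>9 / 4 * (G x)^2\<close> is
      \<open>9 * L\<close> times the lower bound for \<open>u y - u x\<close>, and
      \<open>u x > 0\<close> lets \<open>u y\<close> replace this difference.\<close>
    have "(G y)^2 \<le> (3 / 2 * G x)^2"
      using S(4) G0 by (intro power_mono) auto
    also have "\<dots> = 9 * L * ((G x)^2 / (4 * L))"
      using \<open>0 < L\<close> by (simp add: power2_eq_square)
    also have "\<dots> \<le> 9 * L * max t (u y)"
      using S(2) u_diff ux \<open>0 < L\<close> by (intro mult_left_mono) auto
    finally have Gy: "(G y)^2 \<le> 9 * L * max t (u y)" .
    have uy0: "0 < u y" using incr ux \<open>0 < \<mu>\<close> by simp
    have "0 < G x" using G_lower d0 by (smt (verit) divide_pos_pos)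
    have dy: "0 < deriv \<phi> (u y)"
      using uy0 uy by (intro desingularization_deriv_pos[OF D] lt_\<eta>)
    \<comment> \<open>Concavity bounds the increase of \<open>\<phi>\<close> from below by the slope
      at the upper end \<open>u y\<close>, so the KL inequality is used at \<open>y\<close> and
      \<open>G y\<close> is traded for \<open>3 / 2 * G x\<close>. The quantity
      \<open>G x / (6 * L)\<close> is a third of the step length, hence the factor 3 in
      \<open>P\<close>.\<close>
    have "1 \<le> deriv \<phi> (u y) * G y" using y_near uy0 uy by (rule KL')
    also have "\<dots> \<le> deriv \<phi> (u y) * (3 / 2 * G x)"
      using S(4) dy by (intro mult_left_mono) auto
    finally have "G x / (6 * L) \<le> deriv \<phi> (u y) * (3 / 2 * G x) * (G x / (6 * L))"
      using \<open>0 < G x\<close> \<open>0 < L\<close> by (simp add: field_simps)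
    also have "\<dots> = deriv \<phi> (u y) * ((G x)^2 / (4 * L))"
      by (simp add: power2_eq_square)
    also have "\<dots> \<le> deriv \<phi> (u y) * (u y - u x)"
      using S(2) u_diff dy by (intro mult_left_mono) auto
    also have "\<dots> \<le> \<phi> (u y) - \<phi> (u x)"
      using desingularization_tangent[OF D uy0 lt_\<eta>[OF uy], of "u x"] ux lt_\<eta>[of "u x"] Px
      by (simp add: algebra_simps)
    finally have "norm (y - x) \<le> 3 * (\<phi> (u y) - \<phi> (u x))"
      using S(1) by simp
    then have "norm (y - x0) \<le> 3 * (\<phi> (u y) - \<phi> (u x0))"
      using Px norm_triangle_ineq[of "y - x" "x - x0"] by simp
    then have "P y" using uy Gy incr Px \<open>0 < \<mu>\<close> by (simp add: P_def)
    with incr show ?thesis by blast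
  qed
  have "P x0" using G_x0 x0 \<open>0 < L\<close> \<open>0 < t\<close> by (simp add: P_def)
  \<comment> \<open>The first alternative freezes the iteration once level \<open>t\<close> is
    reached, since \<open>step\<close> applies only below it. For \<open>real n * \<mu> > t\<close>
    both alternatives give \<open>t \<le> u x\<close>.\<close>
  have iter: "\<exists>x. P x \<and> (t \<le> u x \<or> real n * \<mu> \<le> u x)" for n
  proof (induction n)
    case 0
    then show ?case using \<open>P x0\<close> x0 by auto
  next
    case (Suc n)
    then obtain x where x: "P x" "t \<le> u x \<or> real n * \<mu> \<le> u x" by blast
    show ?case
    proof (cases "t \<le> u x")
      case False
      with step[OF x(1)] obtain y where "P y" "u x + \<mu> \<le> u y" by auto
      with False x show ?thesis by (intro exI[of _ y]) (auto simp: algebra_simps)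
    qed (use x in blast)
  qed
  obtain n where "t < real n * \<mu>"
    using reals_Archimedean3[OF \<open>0 < \<mu>\<close>] by blast
  with iter[of n] obtain x where x: "P x" "t \<le> u x" by force
  have Gx: "(G x)^2 \<le> 72 * L * t"
  proof -
    have "(G x)^2 \<le> 9 * L * u x" using x by (simp add: P_def)
    also have "\<dots> \<le> 9 * L * (8 * t)"
      using x \<open>0 < L\<close> by (intro mult_left_mono) (auto simp: P_def)
    finally show ?thesis by simp
  qed
  have dt: "0 < deriv \<phi> t"
    using \<open>0 < t\<close> by (intro desingularization_deriv_pos[OF D] lt_\<eta>) auto
  have "1 \<le> deriv \<phi> (u x) * G x"
    using near[OF x(1)] x \<open>0 < r\<close> \<open>0 < t\<close> by (intro KL') (auto simp: P_def)
  also have "\<dots> \<le> deriv \<phi> t * G x"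
    using x \<open>0 < t\<close>
    by (intro mult_right_mono desingularization_deriv_antimono[OF D] lt_\<eta> G0) (auto simp: P_def)
  finally have "1 / deriv \<phi> t \<le> G x"
    using dt by (simp add: field_simps)
  then have "(1 / deriv \<phi> t)^2 \<le> (G x)^2"
    using dt by (intro power_mono) auto
  with Gx show ?thesis
    by (simp add: inverse_square_deriv_def power_divide)
qed

text \<open>The constant of the bound at a fixed level is independent of \<open>t\<close>, so only
  its smallness conditions remain; they hold for small \<open>t\<close> because
  \<open>\<phi>\<close> is continuous at 0 with value 0.\<close>

lemma inverse_square_deriv_linear_bound:
  fixes f :: "real^'d \<Rightarrow> real"
  assumes D: "desingularization f xbar \<eta> \<phi>" and "C1_function f"
    and lip: "locally_lipschitz (gradient f)"
    and crit: "gradient f xbar = 0" and nmax: "\<not> local_maximizer f xbar"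
  obtains C where "0 < C" "\<forall>\<^sub>F t in at_right 0. inverse_square_deriv \<phi> t \<le> C * t"
proof -
  have diff: "f differentiable (at x)" for x
    using \<open>C1_function f\<close> by (simp add: C1_function_def)
  obtain \<delta> :: ereal where \<delta>: "0 < \<delta>"
    "\<And>x. \<lbrakk>ereal (norm (x - xbar)) < \<delta>; 0 < f x - f xbar; ereal (f x - f xbar) < \<eta>\<rbrakk> \<Longrightarrow>
       1 \<le> deriv \<phi> (f x - f xbar) * norm (gradient f x)"
    using D unfolding desingularization_def by blast
  obtain U L where U: "open U" "xbar \<in> U" "L-lipschitz_on U (gradient f)"
    using lip unfolding locally_lipschitz_def by blast
  obtain r1 where r1: "0 < r1" "ball xbar r1 \<subseteq> U"
    using U(1,2) by (auto simp: open_contains_ball)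
  obtain r2 where r2: "0 < r2" "ereal r2 < \<delta>"
    using ereal_dense2[OF \<delta>(1)] by auto
  define r where "r = min r1 r2"
  have "0 < r" using r1 r2 by (simp add: r_def)
  \<comment> \<open>A Lipschitz constant may be 0, whereas the step factor
    \<open>1 / (2 * L)\<close> calls for a positive one.\<close>
  have "0 < max L 1" by simp
  have lip_r: "(max L 1)-lipschitz_on (ball xbar r) (gradient f)"
    using r1 by (intro lipschitz_on_mono[OF U(3)]) (auto simp: r_def)
  have KL: "1 \<le> deriv \<phi> (f x - f xbar) * norm (gradient f x)"
    if "norm (x - xbar) < r" "0 < f x - f xbar" "ereal (f x - f xbar) < \<eta>" for x
    using that r2(2) by (intro \<delta>(2)) (auto simp: r_def elim: less_trans[rotated])
  obtain a where a: "0 < a" "ereal a < \<eta>"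
    using ereal_dense2[OF desingularization_pos[OF D]] by auto
  have "continuous_on {0..a} \<phi>"
    using a by (intro continuous_on_subset[OF desingularization_continuous[OF D]])
      (auto elim: ereal_less_if_le)
  then have "(\<phi> \<longlongrightarrow> 0) (at_right 0)"
    using continuous_on_Icc_at_rightD[of 0 a \<phi>] a desingularization_zero[OF D] by simp
  then have "\<forall>\<^sub>F t in at_right 0. \<phi> t < r / 12"
    using \<open>0 < r\<close> by (intro order_tendstoD) auto
  then obtain b where b: "0 < b" "\<And>t. 0 < t \<Longrightarrow> t < b \<Longrightarrow> \<phi> t < r / 12"
    by (auto simp: eventually_at_right_field)
  \<comment> \<open>The divisor 8 appears because \<open>8 * t\<close> has to stay below
    \<open>a\<close> and \<open>b\<close>.\<close>
  have "inverse_square_deriv \<phi> t \<le> 72 * max L 1 * t" if "0 < t" "t < min (a / 8) (b / 8)" for t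
    using that a b \<open>0 < r\<close>
    by (intro inverse_square_deriv_bound_at_level[OF D KL diff lip_r \<open>0 < max L 1\<close> crit nmax])
      (auto elim: ereal_less_if_le)
  moreover have "0 < min (a / 8) (b / 8)" using a b by simp
  ultimately have "\<forall>\<^sub>F t in at_right 0. inverse_square_deriv \<phi> t \<le> 72 * max L 1 * t"
    unfolding eventually_at_right_field by blast
  then show ?thesis by (intro that[of "72 * max L 1"]) auto
qed

section \<open>Logarithmic divergence\<close>

lemma not_integrable_on_if_ge_inverse:
  fixes g :: "real \<Rightarrow> real"
  assumes "0 < C" "0 < b" and lower: "\<And>t. 0 < t \<Longrightarrow> t \<le> b \<Longrightarrow> 1 / (C * t) \<le> g t"
  shows "\<not> g integrable_on {0<..b}"
proof
  assume int: "g integrable_on {0<..b}"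
  define I where "I = integral {0<..b} g"
  have le: "(ln b - ln e) / C \<le> I" if "0 < e" "e \<le> b" for e
  proof -
    have "((\<lambda>t. 1 / (C * t)) has_integral ln b / C - ln e / C) {e..b}"
      using that \<open>0 < C\<close>
      by (intro fundamental_theorem_of_calculus)
        (auto intro!: derivative_eq_intros simp: has_real_derivative_iff_has_vector_derivative[symmetric])
    moreover have sub: "g integrable_on {e..b}"
      using that by (intro integrable_on_subinterval[OF int]) auto
    ultimately have "ln b / C - ln e / C \<le> integral {e..b} g"
      using that by (intro has_integral_le[OF _ integrable_integral]) (auto intro: lower)
    also have "\<dots> \<le> I"
    proof -
      have "0 \<le> g t" if "t \<in> {0<..b}" for t
        using lower[of t] that \<open>0 < C\<close> by (auto intro: order_trans[of 0 "1 / (C * t)"])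
      then show ?thesis
        unfolding I_def using \<open>0 < e\<close> by (intro integral_subset_le sub int) auto
    qed
    finally show ?thesis by (simp add: diff_divide_distrib)
  qed
  have "0 \<le> I" using le[of b] \<open>0 < b\<close> by simp
  \<comment> \<open>Chosen so that \<open>(ln b - ln e) / C = I + 1\<close>;
    \<open>0 \<le> I\<close> ensures \<open>e \<le> b\<close>.\<close>
  define e where "e = b * exp (- (C * (I + 1)))"
  have "0 < e" "e \<le> b" using \<open>0 < b\<close> \<open>0 < C\<close> \<open>0 \<le> I\<close> by (auto simp: e_def)
  then have "I + 1 \<le> I"
    using le[of e] \<open>0 < b\<close> \<open>0 < C\<close> by (simp add: e_def ln_mult)
  then show False by simp
qed

section \<open>Landau bound, non-integrability and exponents\<close>

theorem theorem8:
  fixes S :: "nat \<Rightarrow> real list set set"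
    and f :: "real^'d \<Rightarrow> real"
    and xbar :: "real^'d"
  assumes "o_minimal_structure S"
    and "definable_function S f"
    and "C1_function f"
    and "locally_lipschitz (gradient f)"
    and "gradient f xbar = 0"
    and "\<not> local_maximizer f xbar"
  shows "(\<forall>\<eta> \<phi>. desingularization f xbar \<eta> \<phi> \<longrightarrow>
            inverse_square_deriv \<phi> \<in> O[at_right 0](\<lambda>t. t) \<and>
            (\<forall>t. 0 < t \<and> ereal t < \<eta> \<longrightarrow> 1 / inverse_square_deriv \<phi> t = (deriv \<phi> t)^2) \<and>
            \<not> integrable_near_0 \<eta> (\<lambda>t. 1 / inverse_square_deriv \<phi> t)) \<and>
         (\<forall>\<kappa>. 0 \<le> \<kappa> \<and> \<kappa> < 1/2 \<longrightarrow> \<not> KL_exponent f xbar \<kappa>)"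
proof (intro conjI allI impI)
  fix \<eta> \<phi> assume D: "desingularization f xbar \<eta> \<phi>"
  obtain C where C: "0 < C" "\<forall>\<^sub>F t in at_right 0. inverse_square_deriv \<phi> t \<le> C * t"
    using inverse_square_deriv_linear_bound[OF D assms(3-6)] .
  show "inverse_square_deriv \<phi> \<in> O[at_right 0](\<lambda>t. t)"
    using C(2) eventually_at_right_less[of 0]
    by (intro bigoI[of _ C], eventually_elim) (simp add: inverse_square_deriv_def)
  show "1 / inverse_square_deriv \<phi> t = (deriv \<phi> t)^2" if "0 < t \<and> ereal t < \<eta>" for t
    by (simp add: inverse_square_deriv_def)
  obtain b where b: "0 < b" "\<And>t. 0 < t \<Longrightarrow> t < b \<Longrightarrow> inverse_square_deriv \<phi> t \<le> C * t"
    using C(2) by (auto simp: eventually_at_right_field)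
  show "\<not> integrable_near_0 \<eta> (\<lambda>t. 1 / inverse_square_deriv \<phi> t)"
  proof
    let ?g = "\<lambda>t. 1 / inverse_square_deriv \<phi> t"
    assume "integrable_near_0 \<eta> ?g"
    then obtain e where e: "0 < e" "ereal e < \<eta>" "set_integrable lebesgue {0<..e} ?g"
      unfolding integrable_near_0_def by auto
    \<comment> \<open>The bound holds on the open interval up to \<open>b\<close>, while
      \<open>{0<..m}\<close> contains its right end; hence \<open>b / 2\<close>.\<close>
    define m where "m = min e (b / 2)"
    have "0 < m" using e b by (simp add: m_def)
    have "set_integrable lebesgue {0<..m} ?g"
      by (rule set_integrable_subset[OF e(3)]) (auto simp: m_def)
    \<comment> \<open>Lebesgue integrability implies Henstock-Kurzweil integrability, which the
      comparison with the logarithm excludes.\<close>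
    then have "?g integrable_on {0<..m}"
      by (rule set_lebesgue_integral_eq_integral(1))
    moreover have "1 / (C * t) \<le> ?g t" if t: "0 < t" "t \<le> m" for t
    proof (rule divide_left_mono)
      show "inverse_square_deriv \<phi> t \<le> C * t"
        using t b(1) by (intro b(2)) (auto simp: m_def)
      \<comment> \<open>Positivity matters: a zero denominator would make the reciprocal 0 instead
        of large, and the derivative is known to be positive only below
        \<open>\<eta>\<close>.\<close>
      have "ereal t < \<eta>" using t e(2) by (auto simp: m_def elim: ereal_less_if_le)
      then have "0 < inverse_square_deriv \<phi> t"
        using desingularization_deriv_pos[OF D t(1)] by (simp add: inverse_square_deriv_def)
      then show "0 < C * t * inverse_square_deriv \<phi> t"
        using C(1) t(1) by simp
    qed simp
    ultimately show False
      using not_integrable_on_if_ge_inverse[OF C(1) \<open>0 < m\<close>, of ?g] by simp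
  qed
next
  fix \<kappa> :: real assume \<kappa>: "0 \<le> \<kappa> \<and> \<kappa> < 1/2"
  show "\<not> KL_exponent f xbar \<kappa>"
  proof
    assume "KL_exponent f xbar \<kappa>"
    then obtain \<eta> c where c: "0 < c" and D: "desingularization f xbar \<eta> (\<lambda>t. c * t powr (1 - \<kappa>))"
      unfolding KL_exponent_def by auto
    define d where "d = c * (1 - \<kappa>)"
    obtain C where C: "0 < C"
      "\<forall>\<^sub>F t in at_right 0. inverse_square_deriv (\<lambda>t. c * t powr (1 - \<kappa>)) t \<le> C * t"
      using inverse_square_deriv_linear_bound[OF D assms(3-6)] .
    have "0 < d" using c \<kappa> by (simp add: d_def)
    have deriv: "deriv (\<lambda>t. c * t powr (1 - \<kappa>)) t = d * t powr (- \<kappa>)" if "0 < t" for t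
      using that by (intro DERIV_imp_deriv) (auto intro!: derivative_eq_intros simp: d_def)
    \<comment> \<open>The linear bound multiplied by the squared derivative. Since
      \<open>\<kappa> < 1/2\<close>, the exponent \<open>1 - 2 * \<kappa>\<close> is positive and
      the right-hand side tends to 0.\<close>
    have "\<forall>\<^sub>F t in at_right 0. 1 \<le> C * d^2 * t powr (1 - 2 * \<kappa>)"
      using C(2) eventually_at_right_less[of 0]
    proof eventually_elim
      case (elim t)
      have "0 < (d * t powr (- \<kappa>))^2" using \<open>0 < d\<close> elim by simp
      then have "1 \<le> C * t * (d * t powr (- \<kappa>))^2"
        using elim deriv[of t] by (simp add: inverse_square_deriv_def pos_divide_le_eq)
      also have "\<dots> = C * d^2 * (t powr 1 * (t powr (- \<kappa>) * t powr (- \<kappa>)))"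
        using elim by (simp add: power2_eq_square)
      also have "\<dots> = C * d^2 * t powr (1 - 2 * \<kappa>)"
        by (simp only: powr_add[symmetric]) simp
      finally show ?case .
    qed
    moreover have "((\<lambda>t. C * d^2 * t powr (1 - 2 * \<kappa>)) \<longlongrightarrow> C * d^2 * 0) (at_right 0)"
      using \<kappa> eventually_at_right_less[of "0::real"]
      by (intro tendsto_mult tendsto_const tendsto_zero_powrI) (auto elim: eventually_mono)
    then have "\<forall>\<^sub>F t in at_right 0. C * d^2 * t powr (1 - 2 * \<kappa>) < 1"
      by (intro order_tendstoD) auto
    ultimately have "\<forall>\<^sub>F t in at_right (0::real). False"
      by eventually_elim simp
    then show False by simp
  qed
qed

end
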